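(* Let $X$ be a zero-dimensional Polish space, let $k \in \mathbb{N}^+$, and let $\mathscr{B} \colon X \to^? k$ be a continuous constraint satisfaction problem with $\mathsf{vdeg}(\mathscr{B}) < \infty$ and $\mathsf{ord}(\mathscr{B}) < \infty$. If $$\mathsf{p}(\mathscr{B}) \cdot \mathsf{vdeg}(\mathscr{B})^{\mathsf{ord}(\mathscr{B})} \,<\, 1,$$ then $\mathscr{B}$ has a continuous solution $f \colon X \to k$.
   Context: A topological space is Polish if it is separable and completely metrizable; it is zero-dimensional if it has a base consisting of clopen sets. The integer $k$ is identified with the discrete set $\{0,1,\ldots,k-1\}$. A $k$-coloring of a set $S$ is a function $S \to k$. For a set $X$ and a finite set $D \subseteq X$, an $(X,k)$-constraint with domain $D$ is a set $B \subseteq k^D$ of $k$-colorings of $D$; write $\mathrm{dom}(B) = D$. A coloring $f \colon X \to k$ violates $B$ if $f|_D \in B$, and satisfies $B$ otherwise. A constraint satisfaction problem (CSP) $\mathscr{B} \colon X \to^? k$ is a set of $(X,k)$-constraints. A solution to $\mathscr{B}$ is a coloring $f \colon X \to k$ that satisfies every $B \in \mathscr{B}$. Parameters: $\mathbb{P}[B] = |B|/k^{|\mathrm{dom}(B)|}$, $\mathsf{p}(\mathscr{B}) = \sup_{B \in \mathscr{B}} \mathbb{P}[B]$, $\mathsf{vdeg}(\mathscr{B}) = \sup_{x \in X} |\{B \in \mathscr{B} : x \in \mathrm{dom}(B)\}|$, $\mathsf{ord}(\mathscr{B}) = \sup_{B \in \mathscr{B}} |\mathrm{dom}(B)|$. The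 expression $0^0$ is interpreted as $1$. A CSP $\mathscr{B} \colon X \to^? k$ on a zero-dimensional Polish space $X$ is continuous if for every $n \geq 1$, every set $B$ of functions $\{1,\ldots,n\} \to k$, and all clopen $U_2, \ldots, U_n \subseteq X$, the set of all $x_1 \in X$ such that there are $x_2 \in U_2, \ldots, x_n \in U_n$ with $x_1, \ldots, x_n$ distinct and $B(x_1,\ldots,x_n) \in \mathscr{B}$ is clopen. Here $B(x_1,\ldots,x_n) = \{\varphi \circ \iota : \varphi \in B\}$, where $\iota \colon \{x_1,\ldots,x_n\} \to \{1,\ldots,n\}$ is given by $x_i \mapsto i$ (so it is a constraint with domain $\{x_1,\ldots,x_n\}$). *)

theory Defs
  imports "HOL-Analysis.Analysis"
begin

definition polish_topology :: "'a topology \<Rightarrow> bool" where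
  "polish_topology X \<longleftrightarrow> separable_space X \<and> completely_metrizable_space X"

definition clopen_in :: "'a topology \<Rightarrow> 'a set \<Rightarrow> bool" where
  "clopen_in X U \<longleftrightarrow> openin X U \<and> closedin X U"

definition zero_dimensional :: "'a topology \<Rightarrow> bool" where
  "zero_dimensional X \<longleftrightarrow>
     (\<exists>\<C>. (\<forall>V\<in>\<C>. clopen_in X V) \<and>
          (\<forall>U x. openin X U \<and> x \<in> U \<longrightarrow> (\<exists>V\<in>\<C>. x \<in> V \<and> V \<subseteq> U)))"

text \<open>
  A constraint carries its domain explicitly, so that dom is well defined even when the
  set of forbidden colorings is empty. Colorings of a finite domain \<open>D\<close> are the extensional
  functions in \<open>D \<rightarrow>\<^sub>E {..<k}\<close>, so distinct elements are distinct functions on \<open>D\<close>.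
\<close>

type_synonym 'a constraint = "'a set \<times> ('a \<Rightarrow> nat) set"

abbreviation dom_of :: "'a constraint \<Rightarrow> 'a set" where
  "dom_of \<equiv> fst"

abbreviation forbidden :: "'a constraint \<Rightarrow> ('a \<Rightarrow> nat) set" where
  "forbidden \<equiv> snd"

definition is_constraint :: "'a set \<Rightarrow> nat \<Rightarrow> 'a constraint \<Rightarrow> bool" where
  "is_constraint S k C \<longleftrightarrow>
     finite (dom_of C) \<and> dom_of C \<subseteq> S \<and> forbidden C \<subseteq> (dom_of C \<rightarrow>\<^sub>E {..<k})"

definition is_csp :: "'a set \<Rightarrow> nat \<Rightarrow> 'a constraint set \<Rightarrow> bool" where
  "is_csp S k \<B> \<longleftrightarrow> (\<forall>C\<in>\<B>. is_constraint S k C)"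

definition violates :: "('a \<Rightarrow> nat) \<Rightarrow> 'a constraint \<Rightarrow> bool" where
  "violates f C \<longleftrightarrow> restrict f (dom_of C) \<in> forbidden C"

definition is_solution :: "'a set \<Rightarrow> nat \<Rightarrow> 'a constraint set \<Rightarrow> ('a \<Rightarrow> nat) \<Rightarrow> bool" where
  "is_solution S k \<B> f \<longleftrightarrow> f \<in> S \<rightarrow> {..<k} \<and> (\<forall>C\<in>\<B>. \<not> violates f C)"

text \<open>
  The suprema are taken in \<open>ennreal\<close> and \<open>enat\<close>, where the supremum of the empty set is 0
  and that of an unbounded set is \<open>\<infinity>\<close>. Since \<open>card\<close> is 0 on infinite sets, possibly infinite
  sets are counted by \<open>ecard\<close>.
\<close>

definition ecard :: "'b set \<Rightarrow> enat" where
  "ecard A = (if finite A then enat (card A) else \<infinity>)"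

definition constraint_prob :: "nat \<Rightarrow> 'a constraint \<Rightarrow> real" where
  "constraint_prob k C = real (card (forbidden C)) / real k ^ card (dom_of C)"

definition csp_p :: "nat \<Rightarrow> 'a constraint set \<Rightarrow> ennreal" where
  "csp_p k \<B> = (SUP C\<in>\<B>. ennreal (constraint_prob k C))"

definition csp_vdeg :: "'a set \<Rightarrow> 'a constraint set \<Rightarrow> enat" where
  "csp_vdeg S \<B> = (SUP x\<in>S. ecard {C \<in> \<B>. x \<in> dom_of C})"

definition csp_ord :: "'a constraint set \<Rightarrow> enat" where
  "csp_ord \<B> = (SUP C\<in>\<B>. ecard (dom_of C))"

text \<open>
  For \<open>x\<close> injective on \<open>{1..n}\<close>, this is the constraint $B(x_1,\ldots,x_n)$; the map
  \<open>the_inv_into {1..n} x\<close> is $\iota$.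
\<close>

definition constraint_at ::
    "nat \<Rightarrow> (nat \<Rightarrow> nat) set \<Rightarrow> (nat \<Rightarrow> 'a) \<Rightarrow> 'a constraint" where
  "constraint_at n B x =
     (x ` {1..n}, (\<lambda>\<phi>. restrict (\<phi> \<circ> the_inv_into {1..n} x) (x ` {1..n})) ` B)"

definition continuous_csp :: "'a topology \<Rightarrow> nat \<Rightarrow> 'a constraint set \<Rightarrow> bool" where
  "continuous_csp X k \<B> \<longleftrightarrow>
     (\<forall>n B U. 1 \<le> n \<longrightarrow> B \<subseteq> ({1..n} \<rightarrow>\<^sub>E {..<k}) \<longrightarrow> (\<forall>i\<in>{2..n}. clopen_in X (U i)) \<longrightarrow>
        clopen_in X {x1 \<in> topspace X.
          \<exists>x. x 1 = x1 \<and> (\<forall>i\<in>{2..n}. x i \<in> U i) \<and> inj_on x {1..n} \<and>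
              constraint_at n B x \<in> \<B>})"

end

theory Submission
  imports Defs
begin

text \<open>
  The proof derandomizes a union bound by the method of conditional expectations, in such a way
  that every choice is made by a continuous rule.

  Write \<open>d\<close> for the vertex degree. Points are colored one after another. For a constraint \<open>C\<close>,
  consider the conditional probability that \<open>C\<close> is violated if all uncolored points receive
  independent uniform colors. When a point \<open>x\<close> is to be colored, averaging over its
  possible colors gives a color that multiplies the conditional probability of each of the at most
  \<open>d\<close> constraints through \<open>x\<close> by at most \<open>d\<close> (\<open>exists_good_color\<close>). When all points of \<open>C\<close> are colored, its
  conditional probability is either 0 or 1, and it is at most \<open>\<P>[C] * d ^ card (dom C)\<close>, where
  \<open>\<P>[C]\<close> is the unconditional probability. By hypothesis this is less than 1, so \<open>C\<close> is satisfied.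

  To carry this out continuously, points that share no constraint are colored simultaneously.
  The space is a countable union of clopen sets that are independent in this sense
  (\<open>countable_independent_cover\<close>), and they are processed in turn, each point receiving the least good
  color. Which colors are good for \<open>x\<close> depends only on the patterns of the constraints through \<open>x\<close>
  and on the colors already present on their domains. Since there are finitely many such
  configurations and the problem is continuous, each stage is a coloring with clopen
  fibres (\<open>clopen_in_local\<close>). Every point is colored after finitely many stages and its color never
  changes afterwards, so each fibre of the limit is a union of clopen sets, and the limit is
  continuous. Because domains are finite, infinitely many stages do no harm: only
  those that color a point of \<open>C\<close> change the conditional probability of \<open>C\<close>.
\<close>

section \<open>Topological preliminaries\<close>

lemma clopen_in_topspace: "clopen_in X (topspace X)"
  and clopen_in_empty: "clopen_in X {}"
  by (simp_all add: clopen_in_def)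

lemma clopen_in_Int: "clopen_in X A \<Longrightarrow> clopen_in X B \<Longrightarrow> clopen_in X (A \<inter> B)"
  and clopen_in_Un: "clopen_in X A \<Longrightarrow> clopen_in X B \<Longrightarrow> clopen_in X (A \<union> B)"
  and clopen_in_Diff: "clopen_in X A \<Longrightarrow> clopen_in X B \<Longrightarrow> clopen_in X (A - B)"
  by (auto simp: clopen_in_def openin_diff closedin_diff)

lemma clopen_in_UN:
  assumes "finite I" "\<And>i. i \<in> I \<Longrightarrow> clopen_in X (A i)"
  shows "clopen_in X (\<Union>i\<in>I. A i)"
  using assms by (induction I rule: finite_induct) (auto simp: clopen_in_empty clopen_in_Un)

text \<open>Colorings are functions with finitely many values, and continuity of such a function is
  used in the form that every fibre is clopen.\<close>

definition clopen_fibres :: "'a topology \<Rightarrow> nat \<Rightarrow> ('a \<Rightarrow> nat) \<Rightarrow> bool" where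
  "clopen_fibres X m f \<longleftrightarrow>
     f \<in> topspace X \<rightarrow> {..m} \<and> (\<forall>c. clopen_in X {x \<in> topspace X. f x = c})"

lemma separable_metrizable_imp_second_countable:
  assumes "metrizable_space X" "separable_space X"
  shows "second_countable X"
proof -
  obtain M \<delta> where M: "Metric_space M \<delta>" and X: "X = Metric_space.mtopology M \<delta>"
    using assms(1) by (auto simp: metrizable_space_def)
  interpret Metric_space M \<delta> by (rule M)
  obtain D where D: "countable D" "D \<subseteq> M" "mtopology closure_of D = M"
    using assms(2) by (auto simp: separable_space_def X)
  define \<C> where "\<C> = (\<lambda>(c, n). mball c (inverse (real (Suc n)))) ` (D \<times> UNIV)"
  have "\<exists>V\<in>\<C>. x \<in> V \<and> V \<subseteq> U" if U: "openin mtopology U" "x \<in> U" for U x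
  proof -
    obtain \<epsilon> where \<epsilon>: "0 < \<epsilon>" "mball x \<epsilon> \<subseteq> U" and "x \<in> M"
      using U unfolding openin_mtopology by blast
    obtain n where n: "inverse (real (Suc n)) < \<epsilon> / 2"
      using reals_Archimedean[of "\<epsilon> / 2"] \<epsilon>(1) by auto
    obtain c where c: "c \<in> D" "c \<in> mball x (inverse (real (Suc n)))"
    proof -
      have "x \<in> mtopology closure_of D" "0 < inverse (real (Suc n))"
        using D(3) \<open>x \<in> M\<close> by simp_all
      then show thesis
        using that unfolding metric_closure_of by blast
    qed
    have "mball c (inverse (real (Suc n))) \<subseteq> mball x \<epsilon>"
    proof
      fix z assume "z \<in> mball c (inverse (real (Suc n)))"
      then show "z \<in> mball x \<epsilon>"
        using c n triangle[of x c z] by auto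
    qed
    moreover have "x \<in> mball c (inverse (real (Suc n)))"
      using c by (simp add: commute)
    ultimately show ?thesis
      using c(1) \<epsilon>(2) unfolding \<C>_def by force
  qed
  moreover have "countable \<C>"
    using D(1) by (simp add: \<C>_def)
  moreover have "\<forall>V\<in>\<C>. openin mtopology V"
    by (auto simp: \<C>_def)
  ultimately show ?thesis
    unfolding second_countable_def X by blast
qed

section \<open>Locally defined sets are clopen\<close>

text \<open>The enumeration may start at any prescribed point of the domain; continuity of a problem
  speaks about the first point only.\<close>

lemma constraint_at_enumeration:
  assumes "is_constraint S k C" "x \<in> dom_of C"
  obtains n B y where "1 \<le> n" "B \<subseteq> ({1..n} \<rightarrow>\<^sub>E {..<k})" "inj_on y {1..n}" "y 1 = x"
    "constraint_at n B y = C"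
proof -
  define D where "D = dom_of C"
  define n where "n = card D"
  have fin: "finite D" and sub: "forbidden C \<subseteq> (D \<rightarrow>\<^sub>E {..<k})" and xD: "x \<in> D"
    using assms by (auto simp: is_constraint_def D_def)
  have n: "1 \<le> n"
    using fin xD by (auto simp: n_def Suc_le_eq card_gt_0_iff)
  have "card {2..n} = card (D - {x})"
    using fin xD by (simp add: n_def)
  then obtain g where g: "bij_betw g {2..n} (D - {x})"
    using fin finite_same_card_bij[of "{2..n}" "D - {x}"] by auto
  define y where "y = g(1 := x)"
  have split: "{1..n} = insert 1 {2..n}"
    using n by auto
  have img: "y ` {1..n} = D"
  proof -
    have "y ` {2..n} = g ` {2..n}"
      by (intro image_cong) (auto simp: y_def)
    moreover have "y 1 = x"
      by (simp add: y_def)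
    ultimately show ?thesis
      unfolding split image_insert using g xD by (auto simp: bij_betw_def)
  qed
  have inj: "inj_on y {1..n}"
    using g unfolding split inj_on_insert by (auto simp: y_def bij_betw_def inj_on_def)
  define B where "B = (\<lambda>\<phi>. restrict (\<phi> \<circ> y) {1..n}) ` forbidden C"
  have B: "B \<subseteq> ({1..n} \<rightarrow>\<^sub>E {..<k})"
    using sub img by (fastforce simp: B_def PiE_iff)
  have inverse: "restrict (restrict (\<phi> \<circ> y) {1..n} \<circ> the_inv_into {1..n} y) D = \<phi>"
    if "\<phi> \<in> forbidden C" for \<phi>
  proof
    fix z
    show "restrict (restrict (\<phi> \<circ> y) {1..n} \<circ> the_inv_into {1..n} y) D z = \<phi> z"
    proof (cases "z \<in> D")
      case True
      then have "the_inv_into {1..n} y z \<in> {1..n}" "y (the_inv_into {1..n} y z) = z"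
        using inj img the_inv_into_into[OF inj, of z "{1..n}"] f_the_inv_into_f[OF inj, of z] by auto
      with True show ?thesis by simp
    next
      case False
      then show ?thesis using that sub by (auto simp: PiE_iff extensional_def)
    qed
  qed
  have "(\<lambda>\<phi>. restrict (restrict (\<phi> \<circ> y) {1..n} \<circ> the_inv_into {1..n} y) D) ` forbidden C
      = (\<lambda>\<phi>. \<phi>) ` forbidden C"
    by (intro image_cong refl inverse)
  then have "constraint_at n B y = (D, forbidden C)"
    unfolding constraint_at_def img B_def image_image by simp
  then have "constraint_at n B y = C"
    by (simp add: D_def)
  with n B inj show thesis
    using that[of n B y] by (simp add: y_def)
qed

locale bounded_continuous_csp =
  fixes X :: "'a topology" and k :: nat and \<B> :: "'a constraint set" and d r :: nat
  assumes csp: "is_csp (topspace X) k \<B>" and cont: "continuous_csp X k \<B>" and k: "1 \<le> k"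
    and ord: "C \<in> \<B> \<Longrightarrow> card (dom_of C) \<le> r"
    and deg: "x \<in> topspace X \<Longrightarrow> finite {C \<in> \<B>. x \<in> dom_of C} \<and> card {C \<in> \<B>. x \<in> dom_of C} \<le> d"
begin

lemma is_constraint: "C \<in> \<B> \<Longrightarrow> is_constraint (topspace X) k C"
  and finite_dom: "C \<in> \<B> \<Longrightarrow> finite (dom_of C)"
  and dom_subset: "C \<in> \<B> \<Longrightarrow> dom_of C \<subseteq> topspace X"
  using csp by (auto simp: is_csp_def is_constraint_def)

text \<open>Whether \<open>x\<close> lies in the set depends on finitely much information: the pattern of a constraint
  through \<open>x\<close> and the values of \<open>f\<close> on its domain. For each of the finitely many
  patterns \<open>B\<close> and value vectors \<open>a\<close>, the points that see them form a set to which
  continuity of the problem applies, with the clopen fibres of \<open>f\<close> in the role of the sets \<open>U\<^sub>i\<close>.\<close>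

lemma clopen_in_local:
  assumes f: "clopen_fibres X m f"
  shows "clopen_in X {x. \<exists>n B y. 1 \<le> n \<and> B \<subseteq> ({1..n} \<rightarrow>\<^sub>E {..<k}) \<and> inj_on y {1..n} \<and> y 1 = x \<and>
            constraint_at n B y \<in> \<B> \<and> P n B (restrict (f \<circ> y) {1..n})}"
    (is "clopen_in X ?L")
proof -
  define T where "T = (SIGMA n : {1..r}. SIGMA B : Pow ({1..n} \<rightarrow>\<^sub>E {..<k}).
      {a \<in> {1..n} \<rightarrow>\<^sub>E {..m}. P n B a})"
  have "finite T"
    unfolding T_def
    by (intro finite_SigmaI finite_Pow_iff[THEN iffD2] finite_PiE finite_subset[OF Collect_restrict])
      auto
  define U where "U a i = {x \<in> topspace X. f x = a i}" for a :: "nat \<Rightarrow> nat" and i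
  define A where "A = (\<lambda>(n, B, a). U a 1 \<inter> {x1 \<in> topspace X. \<exists>x. x 1 = x1 \<and>
      (\<forall>i\<in>{2..n}. x i \<in> U a i) \<and> inj_on x {1..n} \<and> constraint_at n B x \<in> \<B>})"
  have U: "clopen_in X (U a i)" for a i
    using f by (simp add: U_def clopen_fibres_def)
  have "clopen_in X (\<Union>t\<in>T. A t)"
  proof (rule clopen_in_UN[OF \<open>finite T\<close>])
    fix t assume "t \<in> T"
    obtain n B a where t: "t = (n, B, a)" by (cases t)
    with \<open>t \<in> T\<close> have "1 \<le> n" "B \<subseteq> ({1..n} \<rightarrow>\<^sub>E {..<k})"
      by (auto simp: T_def)
    then show "clopen_in X (A t)"
      unfolding A_def t prod.case
      by (intro clopen_in_Int U cont[unfolded continuous_csp_def, rule_format])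
  qed
  also have "(\<Union>t\<in>T. A t) = ?L"
  proof (intro equalityI subsetI)
    fix x1 assume "x1 \<in> (\<Union>t\<in>T. A t)"
    then obtain n B a x where t: "(n, B, a) \<in> T" "x1 \<in> U a 1" "x 1 = x1"
      "\<forall>i\<in>{2..n}. x i \<in> U a i" "inj_on x {1..n}" "constraint_at n B x \<in> \<B>"
      by (auto simp: A_def)
    have "f (x i) = a i" if "i \<in> {1..n}" for i
      using t that by (cases "i = 1") (auto simp: U_def)
    then have "restrict (f \<circ> x) {1..n} = a"
      using t(1) by (auto simp: T_def PiE_iff extensional_def fun_eq_iff)
    with t show "x1 \<in> ?L"
      by (auto simp: T_def intro!: exI[of _ n] exI[of _ B] exI[of _ x])
  next
    fix x1 assume "x1 \<in> ?L"
    then obtain n B y where y: "1 \<le> n" "B \<subseteq> ({1..n} \<rightarrow>\<^sub>E {..<k})" "inj_on y {1..n}" "y 1 = x1"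
      "constraint_at n B y \<in> \<B>" "P n B (restrict (f \<circ> y) {1..n})"
      by auto
    have yX: "y i \<in> topspace X" if "i \<in> {1..n}" for i
      using csp y(5) that by (force simp: is_csp_def is_constraint_def constraint_at_def)
    have "n \<le> r"
      using ord[OF y(5)] y(3) by (simp add: constraint_at_def card_image)
    define a where "a = restrict (f \<circ> y) {1..n}"
    have "a \<in> {1..n} \<rightarrow>\<^sub>E {..m}"
      using yX f unfolding a_def clopen_fibres_def by fastforce
    then have "(n, B, a) \<in> T"
      using y \<open>n \<le> r\<close> by (auto simp: T_def a_def)
    moreover have "x1 \<in> A (n, B, a)"
      using y yX by (auto simp: A_def U_def a_def intro!: exI[of _ y])
    ultimately show "x1 \<in> (\<Union>t\<in>T. A t)" by blast
  qed
  finally show ?thesis .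
qed

section \<open>Covering by independent clopen sets\<close>

text \<open>No two points of an independent set share a constraint, so all its points can
  be colored simultaneously without interference.\<close>

definition independent_set :: "'a set \<Rightarrow> bool" where
  "independent_set W \<longleftrightarrow> (\<forall>C\<in>\<B>. \<forall>x\<in>W \<inter> dom_of C. \<forall>y\<in>W \<inter> dom_of C. x = y)"

definition neighbours_of :: "'a set \<Rightarrow> 'a set" where
  "neighbours_of V = {x. \<exists>C\<in>\<B>. x \<in> dom_of C \<and> (\<exists>y\<in>V \<inter> dom_of C. y \<noteq> x)}"

lemma clopen_in_neighbours_of:
  assumes V: "clopen_in X V"
  shows "clopen_in X (neighbours_of V)"
proof -
  define f where "f x = (if x \<in> V then 1 else 0 :: nat)" for x
  have "V \<subseteq> topspace X"
    using V by (simp add: clopen_in_def openin_subset)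
  then have "{x \<in> topspace X. f x = c} = (if c = 0 then topspace X - V else if c = 1 then V else {})" for c
    by (auto simp: f_def)
  then have f: "clopen_fibres X 1 f"
    using V by (auto simp: clopen_fibres_def f_def clopen_in_empty clopen_in_Diff clopen_in_topspace)
  have "neighbours_of V = {x. \<exists>n B y. 1 \<le> n \<and> B \<subseteq> ({1..n} \<rightarrow>\<^sub>E {..<k}) \<and> inj_on y {1..n} \<and>
      y 1 = x \<and> constraint_at n B y \<in> \<B> \<and> (\<exists>i\<in>{2..n}. restrict (f \<circ> y) {1..n} i = 1)}"
    (is "_ = ?R")
  proof (intro equalityI subsetI)
    fix x assume "x \<in> neighbours_of V"
    then obtain C z where C: "C \<in> \<B>" "x \<in> dom_of C" "z \<in> V" "z \<in> dom_of C" "z \<noteq> x"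
      by (auto simp: neighbours_of_def)
    then obtain n B y where y: "1 \<le> n" "B \<subseteq> ({1..n} \<rightarrow>\<^sub>E {..<k})" "inj_on y {1..n}" "y 1 = x"
      "constraint_at n B y = C"
      using constraint_at_enumeration[OF is_constraint] by metis
    from C(4) y(5) obtain i where i: "i \<in> {1..n}" "y i = z"
      by (auto simp: constraint_at_def)
    with y(4) C(5) have "i \<in> {2..n}"
      by (cases "i = 1") auto
    with i have "\<exists>i\<in>{2..n}. restrict (f \<circ> y) {1..n} i = 1"
      using C(3) by (auto simp: f_def intro!: bexI[of _ i])
    then show "x \<in> ?R"
      using y C(1) by blast
  next
    fix x assume "x \<in> ?R"
    then obtain n B y i where y: "1 \<le> n" "inj_on y {1..n}" "y 1 = x"
      "constraint_at n B y \<in> \<B>" "i \<in> {2..n}" "y i \<in> V"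
      by (auto simp: f_def split: if_splits)
    then have "y i \<noteq> y 1"
      by (auto dest!: inj_onD)
    then have "x \<in> dom_of (constraint_at n B y) \<and> y i \<in> V \<inter> dom_of (constraint_at n B y) \<and> y i \<noteq> x"
      using y by (auto simp: constraint_at_def)
    then show "x \<in> neighbours_of V"
      using y(4) unfolding neighbours_of_def by blast
  qed
  then show ?thesis
    using clopen_in_local[OF f, where P = "\<lambda>n B a. \<exists>i\<in>{2..n}. a i = 1"] by simp
qed

text \<open>Each point \<open>x\<close> has finitely many neighbours, so some clopen \<open>V\<close> around \<open>x\<close> misses them all.
  Deleting from \<open>V\<close> the points that have a neighbour in \<open>V\<close> makes it independent and keeps \<open>x\<close>.
  Second countability leaves countably many of these sets.\<close>

lemma countable_independent_cover:
  assumes polish: "polish_topology X" and zd: "zero_dimensional X"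
  obtains W :: "nat \<Rightarrow> 'a set" where "\<And>n. clopen_in X (W n)" "\<And>n. independent_set (W n)"
    "(\<Union>n. W n) = topspace X"
proof -
  define \<U> where "\<U> = {W. clopen_in X W \<and> independent_set W}"
  have metr: "metrizable_space X" and sep: "separable_space X"
    using polish by (auto simp: polish_topology_def completely_metrizable_imp_metrizable_space)
  have t1: "t1_space X"
    using metr by (simp add: metrizable_imp_t1_space)
  have "\<exists>W\<in>\<U>. x \<in> W" if x: "x \<in> topspace X" for x
  proof -
    define N where "N = (\<Union>C\<in>{C \<in> \<B>. x \<in> dom_of C}. dom_of C) - {x}"
    have "finite N" "N \<subseteq> topspace X"
      using deg[OF x] finite_dom dom_subset unfolding N_def by (blast, blast)
    then have "closedin X N"
      using t1 by (simp add: t1_space_closedin_finite)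
    then have "openin X (topspace X - N)" "x \<in> topspace X - N"
      using x by (auto simp: N_def)
    then obtain V where V: "clopen_in X V" "x \<in> V" "V \<subseteq> topspace X - N"
      using zd unfolding zero_dimensional_def by meson
    have "clopen_in X (V - neighbours_of V)"
      using clopen_in_Diff[OF V(1)] clopen_in_neighbours_of[OF V(1)] by blast
    moreover have "independent_set (V - neighbours_of V)"
      by (auto simp: independent_set_def neighbours_of_def)
    moreover have "x \<notin> neighbours_of V"
      using V(3) by (auto simp: neighbours_of_def N_def)
    ultimately show ?thesis
      using V(2) by (auto simp: \<U>_def)
  qed
  moreover have "W \<subseteq> topspace X" if "W \<in> \<U>" for W
    using that by (auto simp: \<U>_def clopen_in_def dest: openin_subset)
  ultimately have "\<Union>\<U> = topspace X" by blast
  moreover have "Lindelof_space X"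
    using metr sep separable_metrizable_imp_second_countable second_countable_imp_Lindelof_space by blast
  ultimately obtain \<V> where \<V>: "countable \<V>" "\<V> \<subseteq> \<U>" "\<Union>\<V> = topspace X"
    using Lindelof_spaceD[of X \<U>] by (auto simp: \<U>_def clopen_in_def)
  (* Only nonempty sets can be enumerated, and the subcover may be empty if the space is. *)
  define W where "W = from_nat_into (insert {} \<V>)"
  have ran: "range W = insert {} \<V>"
    using \<V>(1) by (simp add: W_def range_from_nat_into)
  have empty: "{} \<in> \<U>"
    by (simp add: \<U>_def clopen_in_empty independent_set_def)
  have "W n \<in> \<U>" for n
    using rangeI[of W n] \<V>(2) empty unfolding ran by auto
  moreover have "(\<Union>n. W n) = topspace X"
    using \<V>(3) by (simp add: ran)
  ultimately show thesis
    by (intro that[of W]) (simp_all add: \<U>_def)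
qed

end

section \<open>The conditional probability of a violation\<close>

text \<open>A partial coloring with the colors below \<open>k\<close> is a total function; any value from \<open>k\<close> on
  means uncolored. Below, \<open>violation_prob k f C\<close> is the conditional probability that \<open>C\<close> is
  violated when the uncolored points receive independent uniform colors.\<close>

definition extensions :: "nat \<Rightarrow> ('a \<Rightarrow> nat) \<Rightarrow> 'a constraint \<Rightarrow> ('a \<Rightarrow> nat) set" where
  "extensions k f C = {\<phi> \<in> forbidden C. \<forall>y\<in>dom_of C. f y < k \<longrightarrow> \<phi> y = f y}"

definition violation_prob :: "nat \<Rightarrow> ('a \<Rightarrow> nat) \<Rightarrow> 'a constraint \<Rightarrow> real" where
  "violation_prob k f C = real (card (extensions k f C)) / real k ^ card {y \<in> dom_of C. \<not> f y < k}"

lemma violation_prob_cong: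
  assumes "\<And>y. y \<in> dom_of C \<Longrightarrow> f y = g y"
  shows "violation_prob k f C = violation_prob k g C"
proof -
  have "extensions k f C = extensions k g C" "{y \<in> dom_of C. \<not> f y < k} = {y \<in> dom_of C. \<not> g y < k}"
    using assms by (auto simp: extensions_def)
  then show ?thesis by (simp add: violation_prob_def)
qed

lemma violation_prob_nonneg: "0 \<le> violation_prob k f C"
  by (simp add: violation_prob_def)

lemma finite_forbidden: "is_constraint S k C \<Longrightarrow> finite (forbidden C)"
  by (auto simp: is_constraint_def intro: finite_subset finite_PiE)

text \<open>Transport along the enumeration of the domain: this is what makes a condition on violation
  probabilities local in the sense of \<open>clopen_in_local\<close>.\<close>

lemma violation_prob_constraint_at:
  assumes inj: "inj_on y {1..n}" and B: "B \<subseteq> ({1..n} \<rightarrow>\<^sub>E {..<k})"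
  shows "violation_prob k f (constraint_at n B y) = violation_prob k (f \<circ> y) ({1..n}, B)"
proof -
  define \<iota> where "\<iota> = the_inv_into {1..n} y"
  define h where "h \<phi> = restrict (\<phi> \<circ> \<iota>) (y ` {1..n})" for \<phi> :: "nat \<Rightarrow> nat"
  have \<iota>: "\<iota> (y i) = i" if "i \<in> {1..n}" for i
    using inj that by (simp add: \<iota>_def the_inv_into_f_f)
  have h: "h \<phi> (y i) = \<phi> i" if "i \<in> {1..n}" for \<phi> i
    using \<iota> that by (simp add: h_def)
  have "inj_on h B"
  proof (rule inj_onI)
    fix \<phi> \<psi> assume *: "\<phi> \<in> B" "\<psi> \<in> B" "h \<phi> = h \<psi>"
    then have "\<phi> i = \<psi> i" if "i \<in> {1..n}" for i
      using h[OF that] by metis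
    moreover have "\<phi> \<in> {1..n} \<rightarrow>\<^sub>E {..<k}" "\<psi> \<in> {1..n} \<rightarrow>\<^sub>E {..<k}"
      using * B by auto
    ultimately show "\<phi> = \<psi>"
      by (metis PiE_ext)
  qed
  then have "inj_on h (extensions k (f \<circ> y) ({1..n}, B))"
    by (rule inj_on_subset) (auto simp: extensions_def)
  moreover have "extensions k f (constraint_at n B y) = h ` extensions k (f \<circ> y) ({1..n}, B)"
  proof -
    have "constraint_at n B y = (y ` {1..n}, h ` B)"
      by (simp add: constraint_at_def h_def[abs_def] \<iota>_def)
    then show ?thesis
      using h by (auto simp: extensions_def)
  qed
  ultimately have 1: "card (extensions k f (constraint_at n B y)) = card (extensions k (f \<circ> y) ({1..n}, B))"
    by (simp add: card_image)
  have "{z \<in> dom_of (constraint_at n B y). \<not> f z < k} = y ` {i \<in> {1..n}. \<not> (f \<circ> y) i < k}"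
    by (auto simp: constraint_at_def)
  then have "card {z \<in> dom_of (constraint_at n B y). \<not> f z < k} = card {i \<in> {1..n}. \<not> (f \<circ> y) i < k}"
    by (simp only:) (rule card_image, rule inj_on_subset[OF inj], auto)
  with 1 show ?thesis by (simp add: violation_prob_def)
qed

text \<open>The law of total probability for the color of one uncolored point.\<close>

lemma sum_violation_prob:
  assumes C: "is_constraint S k C" and x: "x \<in> dom_of C" "\<not> f x < k"
  shows "(\<Sum>c<k. violation_prob k (f(x := c)) C) = real k * violation_prob k f C"
proof -
  define u where "u = card {y \<in> dom_of C. \<not> f y < k} - 1"
  have fin: "finite {y \<in> dom_of C. \<not> f y < k}"
    using C by (simp add: is_constraint_def)
  have u: "card {y \<in> dom_of C. \<not> f y < k} = Suc u"
    unfolding u_def using fin x by (intro Suc_pred'[OF card_gt_0_iff[THEN iffD2]]) auto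
  have "{y \<in> dom_of C. \<not> (f(x := c)) y < k} = {y \<in> dom_of C. \<not> f y < k} - {x}" if "c < k" for c
    using that by auto
  then have u': "card {y \<in> dom_of C. \<not> (f(x := c)) y < k} = u" if "c < k" for c
    using that u fin x by simp
  have ext: "extensions k (f(x := c)) C = {\<phi> \<in> extensions k f C. \<phi> x = c}" if "c < k" for c
    using that x by (auto simp: extensions_def)
  have fE: "finite (extensions k f C)"
    using finite_forbidden[OF C] by (simp add: extensions_def)
  have "(\<lambda>\<phi>. \<phi> x) ` extensions k f C \<subseteq> {..<k}"
    using C x by (fastforce simp: extensions_def is_constraint_def)
  then have "card (extensions k f C) = (\<Sum>c<k. card {\<phi> \<in> extensions k f C. \<phi> x = c})"
    using sum.group[OF fE, of "{..<k}" "\<lambda>\<phi>. \<phi> x" "\<lambda>_. 1::nat"] by (simp add: fE)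
  then have "(\<Sum>c<k. real (card (extensions k (f(x := c)) C))) = real (card (extensions k f C))"
    by (simp add: ext)
  moreover have "(\<Sum>c<k. violation_prob k (f(x := c)) C) = (\<Sum>c<k. real (card (extensions k (f(x := c)) C)) / real k ^ u)"
    using u' by (intro sum.cong) (simp_all only: violation_prob_def lessThan_iff)
  moreover have "violation_prob k f C = real (card (extensions k f C)) / (real k * real k ^ u)"
    by (simp add: violation_prob_def u)
  ultimately show ?thesis
    by (cases "k = 0") (simp_all flip: sum_divide_distrib)
qed

text \<open>Choose the color \<open>c\<close> uniformly. For each constraint through \<open>x\<close> the ratio of the new to the
  old violation probability has expectation at most 1, so the sum of the ratios over the
  at most \<open>d\<close> constraints has expectation at most \<open>d\<close>, and some \<open>c\<close> keeps every ratio at most \<open>d\<close>.\<close>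

lemma exists_good_color:
  assumes k: "1 \<le> k" and S: "finite S" "card S \<le> d"
    and C: "\<And>C. C \<in> S \<Longrightarrow> is_constraint V k C \<and> x \<in> dom_of C" and x: "\<not> f x < k"
  shows "\<exists>c<k. \<forall>C\<in>S. violation_prob k (f(x := c)) C \<le> real d * violation_prob k f C"
proof (rule ccontr)
  assume "\<not> ?thesis"
  then obtain bad where bad: "bad c \<in> S"
      "real d * violation_prob k f (bad c) < violation_prob k (f(x := c)) (bad c)" if "c < k" for c
    by (metis not_less)
  define ratio where "ratio c C = violation_prob k (f(x := c)) C / violation_prob k f C" for c C
  have ratio_nonneg: "0 \<le> ratio c C" for c C
    by (simp add: ratio_def violation_prob_nonneg)
  have total: "(\<Sum>c<k. violation_prob k (f(x := c)) C) = real k * violation_prob k f C" if "C \<in> S" for C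
    using C[OF that] x by (intro sum_violation_prob[where S = V]) simp_all
  have large: "real d < (\<Sum>C\<in>S. ratio c C)" if c: "c < k" for c
  proof -
    have "violation_prob k (f(x := c)) (bad c) \<le> real k * violation_prob k f (bad c)"
      using member_le_sum[of c "{..<k}" "\<lambda>c'. violation_prob k (f(x := c')) (bad c)"] c
        total[OF bad(1)[OF c]] by (simp add: violation_prob_nonneg)
    then have "0 < violation_prob k f (bad c)"
      using bad(2)[OF c] violation_prob_nonneg[of k f "bad c"] by (cases "violation_prob k f (bad c) = 0") auto
    then have "real d < ratio c (bad c)"
      using bad(2)[OF c] by (simp add: ratio_def pos_less_divide_eq)
    also have "\<dots> \<le> (\<Sum>C\<in>S. ratio c C)"
      by (rule member_le_sum) (use S(1) bad(1)[OF c] ratio_nonneg in auto)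
    finally show ?thesis .
  qed
  have "real k * real d = (\<Sum>c<k. real d)"
    by simp
  also have "\<dots> < (\<Sum>c<k. \<Sum>C\<in>S. ratio c C)"
    by (rule sum_strict_mono) (use k large in \<open>auto simp: lessThan_empty_iff\<close>)
  also have "\<dots> = (\<Sum>C\<in>S. \<Sum>c<k. ratio c C)"
    by (rule sum.swap)
  (* The inner sum is k, or 0 if the violation probability is already 0 and each ratio is 0 / 0 = 0. *)
  also have "\<dots> \<le> (\<Sum>C\<in>S. real k)"
    by (rule sum_mono) (simp add: ratio_def total flip: sum_divide_distrib)
  also have "\<dots> \<le> real k * real d"
    using S(2) by (simp add: mult.commute[of "real k"] mult_right_mono)
  finally show False by simp
qed

section \<open>Coloring one independent set after another\<close>

context bounded_continuous_csp
begin

definition bad_set :: "('a \<Rightarrow> nat) \<Rightarrow> nat \<Rightarrow> 'a set" where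
  "bad_set f c = {x. \<exists>C\<in>\<B>. x \<in> dom_of C \<and>
     real d * violation_prob k f C < violation_prob k (f(x := c)) C}"

definition color_step :: "'a set \<Rightarrow> ('a \<Rightarrow> nat) \<Rightarrow> 'a \<Rightarrow> nat" where
  "color_step W f x = (if x \<in> W \<and> \<not> f x < k then LEAST c. c < k \<and> x \<notin> bad_set f c else f x)"

lemma clopen_in_bad_set:
  assumes f: "clopen_fibres X m f"
  shows "clopen_in X (bad_set f c)"
proof -
  define P where "P n B a \<longleftrightarrow> real d * violation_prob k a ({1..n}, B)
    < violation_prob k (a(1 := c)) ({1..n}, B)" for n B and a :: "nat \<Rightarrow> nat"
  have P: "P n B (restrict (f \<circ> y) {1..n}) \<longleftrightarrow> real d * violation_prob k f (constraint_at n B y)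
      < violation_prob k (f(y 1 := c)) (constraint_at n B y)"
    if "1 \<le> n" "inj_on y {1..n}" "B \<subseteq> ({1..n} \<rightarrow>\<^sub>E {..<k})" for n B y
  proof -
    have "(f(y 1 := c) \<circ> y) i = ((restrict (f \<circ> y) {1..n})(1 := c)) i" if "i \<in> {1..n}" for i
      using that \<open>1 \<le> n\<close> inj_onD[OF \<open>inj_on y {1..n}\<close>, of i 1] by auto
    then have "violation_prob k (f(y 1 := c) \<circ> y) ({1..n}, B)
        = violation_prob k ((restrict (f \<circ> y) {1..n})(1 := c)) ({1..n}, B)"
      by (intro violation_prob_cong) simp
    moreover have "violation_prob k (f \<circ> y) ({1..n}, B) = violation_prob k (restrict (f \<circ> y) {1..n}) ({1..n}, B)"
      by (intro violation_prob_cong) simp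
    ultimately show ?thesis
      by (simp only: P_def violation_prob_constraint_at[OF that(2,3)])
  qed
  have "bad_set f c = {x. \<exists>n B y. 1 \<le> n \<and> B \<subseteq> ({1..n} \<rightarrow>\<^sub>E {..<k}) \<and> inj_on y {1..n} \<and> y 1 = x \<and>
      constraint_at n B y \<in> \<B> \<and> P n B (restrict (f \<circ> y) {1..n})}" (is "_ = ?R")
  proof (intro equalityI subsetI)
    fix x assume "x \<in> bad_set f c"
    then obtain C where C: "C \<in> \<B>" "x \<in> dom_of C"
        "real d * violation_prob k f C < violation_prob k (f(x := c)) C"
      by (auto simp: bad_set_def)
    obtain n B y where "1 \<le> n" "B \<subseteq> ({1..n} \<rightarrow>\<^sub>E {..<k})" "inj_on y {1..n}" "y 1 = x"
        "constraint_at n B y = C"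
      using constraint_at_enumeration[OF is_constraint[OF C(1)] C(2)] by metis
    with C P[of n y B] show "x \<in> ?R" by blast
  next
    fix x assume "x \<in> ?R"
    then obtain n B y where y: "1 \<le> n" "B \<subseteq> ({1..n} \<rightarrow>\<^sub>E {..<k})" "inj_on y {1..n}" "y 1 = x"
        "constraint_at n B y \<in> \<B>" "P n B (restrict (f \<circ> y) {1..n})"
      by blast
    moreover have "x \<in> dom_of (constraint_at n B y)"
      using y(1,4) by (auto simp: constraint_at_def)
    ultimately show "x \<in> bad_set f c"
      using P[of n y B] unfolding bad_set_def by blast
  qed
  then show ?thesis
    using clopen_in_local[OF f, where P = P] by simp
qed

lemma color_step_good:
  assumes "x \<in> topspace X" "x \<in> W" "\<not> f x < k"
  shows "color_step W f x < k" "x \<notin> bad_set f (color_step W f x)"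
proof -
  have "\<exists>c<k. \<forall>C\<in>{C \<in> \<B>. x \<in> dom_of C}. violation_prob k (f(x := c)) C \<le> real d * violation_prob k f C"
    by (rule exists_good_color[where V = "topspace X"]) (use assms k deg is_constraint in auto)
  then have "\<exists>c. c < k \<and> x \<notin> bad_set f c"
    by (auto simp: bad_set_def not_less)
  from LeastI_ex[OF this] show "color_step W f x < k" "x \<notin> bad_set f (color_step W f x)"
    using assms by (auto simp: color_step_def)
qed

text \<open>The least good color is \<open>c\<close> exactly if \<open>c\<close> is not bad and all smaller colors are, which is a
  Boolean combination of finitely many clopen conditions.\<close>

lemma clopen_fibres_color_step:
  assumes W: "clopen_in X W" and f: "clopen_fibres X k f"
  shows "clopen_fibres X k (color_step W f)"
proof -
  let ?U = "\<lambda>c. {x \<in> topspace X. f x = c}"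
  have U: "clopen_in X (?U c)" for c
    using f by (simp add: clopen_fibres_def)
  have WX: "W \<subseteq> topspace X"
    using W by (simp add: clopen_in_def openin_subset)
  have val: "f x \<le> k" if "x \<in> topspace X" for x
    using f that by (auto simp: clopen_fibres_def)
  have range: "color_step W f x \<le> k" if "x \<in> topspace X" for x
  proof (cases "x \<in> W \<and> \<not> f x < k")
    case True
    then show ?thesis using color_step_good(1)[OF that] by (meson less_imp_le)
  next
    case False
    then have "color_step W f x = f x" by (auto simp: color_step_def)
    then show ?thesis using val[OF that] by simp
  qed
  have "clopen_in X {x \<in> topspace X. color_step W f x = c}" for c
  proof (cases "c < k")
    case True
    define A where "A = (W \<inter> ?U k) - bad_set f c - (\<Union>c'\<in>{..<c}. topspace X - bad_set f c')"
    have "clopen_in X (?U c \<union> A)"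
      unfolding A_def
      by (intro clopen_in_Un clopen_in_Diff clopen_in_Int clopen_in_UN U W clopen_in_bad_set[OF f]
          clopen_in_topspace finite_lessThan)
    also have "?U c \<union> A = {x \<in> topspace X. color_step W f x = c}"
    proof (intro set_eqI)
      fix x
      show "x \<in> ?U c \<union> A \<longleftrightarrow> x \<in> {x \<in> topspace X. color_step W f x = c}"
      proof (cases "x \<in> W \<and> \<not> f x < k")
        case new: True
        then have x: "x \<in> topspace X" and fx: "f x = k"
          using WX val[of x] by auto
        have step: "color_step W f x = (LEAST c. c < k \<and> x \<notin> bad_set f c)"
          using new by (simp add: color_step_def)
        have "x \<in> ?U c \<union> A \<longleftrightarrow> x \<notin> bad_set f c \<and> (\<forall>c'<c. x \<in> bad_set f c')"
          using new x fx True by (auto simp: A_def)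
        also have "\<dots> \<longleftrightarrow> color_step W f x = c"
        proof
          assume "x \<notin> bad_set f c \<and> (\<forall>c'<c. x \<in> bad_set f c')"
          then show "color_step W f x = c"
            unfolding step using True by (intro Least_equality) (auto simp: not_less[symmetric])
        next
          assume c: "color_step W f x = c"
          have "x \<in> bad_set f c'" if "c' < c" for c'
            using not_less_Least[of c' "\<lambda>c. c < k \<and> x \<notin> bad_set f c"] that c True
            unfolding step by auto
          then show "x \<notin> bad_set f c \<and> (\<forall>c'<c. x \<in> bad_set f c')"
            using color_step_good(2)[of x W f] new x c by auto
        qed
        finally show ?thesis using x by simp
      next
        case False
        then show ?thesis using True by (auto simp: A_def color_step_def)
      qed
    qed
    finally show ?thesis .
  next
    case False
    have "{x \<in> topspace X. color_step W f x = c} = ?U c - W"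
    proof (intro set_eqI)
      fix x
      have "color_step W f x < k" if "x \<in> topspace X" "x \<in> W"
        using color_step_good(1)[OF that, of f] by (cases "f x < k") (simp_all add: color_step_def)
      moreover have "color_step W f x = f x" if "x \<notin> W"
        using that by (simp add: color_step_def)
      moreover have "f x \<noteq> c" if "x \<in> topspace X" "x \<in> W" "f x < k"
        using False that by auto
      ultimately show "x \<in> {x \<in> topspace X. color_step W f x = c} \<longleftrightarrow> x \<in> ?U c - W"
        using False by (cases "x \<in> W") auto
    qed
    then show ?thesis
      using clopen_in_Diff[OF U W] by simp
  qed
  with range show ?thesis
    by (auto simp: clopen_fibres_def)
qed

text \<open>The invariant of the construction: every colored point of \<open>C\<close> has cost at most a factor \<open>d\<close>.\<close>

definition within_budget :: "('a \<Rightarrow> nat) \<Rightarrow> 'a constraint \<Rightarrow> bool" where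
  "within_budget f C \<longleftrightarrow>
     violation_prob k f C \<le> constraint_prob k C * real d ^ card {y \<in> dom_of C. f y < k}"

text \<open>Since \<open>W\<close> is independent, the step changes at most one point of \<open>C\<close>. On the domain of \<open>C\<close> it
  therefore agrees with the one-point update for which \<open>bad_set\<close> was defined.\<close>

lemma within_budget_color_step:
  assumes W: "independent_set W" and C: "C \<in> \<B>" and f: "within_budget f C"
  shows "within_budget (color_step W f) C"
proof (cases "\<exists>x \<in> dom_of C \<inter> W. \<not> f x < k")
  case False
  then have same: "color_step W f y = f y" if "y \<in> dom_of C" for y
    using that by (auto simp: color_step_def)
  then have "{y \<in> dom_of C. color_step W f y < k} = {y \<in> dom_of C. f y < k}"
    by auto
  with f violation_prob_cong[of C, OF same] show ?thesis
    by (simp add: within_budget_def)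
next
  case True
  then obtain x where x: "x \<in> dom_of C" "x \<in> W" "\<not> f x < k" by auto
  then have xX: "x \<in> topspace X"
    using dom_subset[OF C] by auto
  let ?c = "color_step W f x"
  have same: "color_step W f y = (f(x := ?c)) y" if "y \<in> dom_of C" for y
    using W C x that by (auto simp: independent_set_def color_step_def)
  have "{y \<in> dom_of C. color_step W f y < k} = insert x {y \<in> dom_of C. f y < k}"
  proof (rule set_eqI)
    fix y
    show "y \<in> {y \<in> dom_of C. color_step W f y < k} \<longleftrightarrow> y \<in> insert x {y \<in> dom_of C. f y < k}"
      using same[of y] x(1) color_step_good(1)[where f = f, OF xX x(2,3)] by (cases "y = x") auto
  qed
  then have card: "card {y \<in> dom_of C. color_step W f y < k} = Suc (card {y \<in> dom_of C. f y < k})"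
    using finite_dom[OF C] x(3) by simp
  have "violation_prob k (color_step W f) C = violation_prob k (f(x := ?c)) C"
    using same by (rule violation_prob_cong)
  also have "\<dots> \<le> real d * violation_prob k f C"
    using color_step_good(2)[where f = f, OF xX x(2,3)] x(1) C unfolding bad_set_def mem_Collect_eq
    by (meson not_less)
  also have "\<dots> \<le> real d * (constraint_prob k C * real d ^ card {y \<in> dom_of C. f y < k})"
    using f by (intro mult_left_mono) (auto simp: within_budget_def)
  finally show ?thesis
    by (simp add: within_budget_def card mult_ac)
qed

text \<open>Every point is colored at a finite stage and keeps its color, so the colorings converge.
  A constraint has a finite domain, hence is fully colored at some stage; its violation
  probability is then the number of forbidden colorings that occur, and the budget forces
  this number below 1.\<close>

theorem continuous_solution:
  assumes polish: "polish_topology X" and zd: "zero_dimensional X"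
    and small: "\<And>C. C \<in> \<B> \<Longrightarrow> constraint_prob k C * real d ^ card (dom_of C) < 1"
  shows "\<exists>f. continuous_map X (discrete_topology {..<k}) f \<and> is_solution (topspace X) k \<B> f"
proof -
  obtain W :: "nat \<Rightarrow> 'a set" where W: "\<And>n. clopen_in X (W n)" "\<And>n. independent_set (W n)"
    "(\<Union>n. W n) = topspace X"
    using countable_independent_cover[OF polish zd] by metis
  define F where "F = rec_nat (\<lambda>_. k) (\<lambda>n. color_step (W n))"
  have F0: "F 0 = (\<lambda>_. k)" and FS: "F (Suc n) = color_step (W n) (F n)" for n
    by (simp_all add: F_def)
  have "{x. k = c \<and> x \<in> topspace X} = (if c = k then topspace X else {})" for c
    by auto
  then have fibres: "clopen_fibres X k (F n)" for n
    by (induction n) (auto simp: F0 FS clopen_fibres_def[of X k "\<lambda>_. k"] clopen_in_topspace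
        clopen_in_empty W clopen_fibres_color_step conj_commute)
  have budget: "within_budget (F n) C" if "C \<in> \<B>" for n C
  proof (induction n)
    case 0
    show ?case
      by (simp add: F0 within_budget_def violation_prob_def extensions_def constraint_prob_def)
  qed (simp add: FS within_budget_color_step W that)
  have step: "F (Suc n) x = F n x" if "F n x < k" for n x
    using that by (simp add: FS color_step_def)
  have keep: "F m x = F n x" if "F n x < k" "n \<le> m" for m n x
    using that(2,1) by (induction rule: dec_induct) (auto simp: step)
  have agree: "F m x = F n x" if "F n x < k" "F m x < k" for m n x
    using keep[OF that(1), of m] keep[OF that(2), of n] by (cases "n \<le> m") auto
  have colored: "\<exists>n. F n x < k" if x: "x \<in> topspace X" for x
  proof -
    obtain n where n: "x \<in> W n" using W(3) x by auto
    have "F (Suc n) x < k"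
      using color_step_good(1)[OF x n, of "F n"] step[of n x] by (cases "F n x < k") (simp_all add: FS)
    then show ?thesis ..
  qed
  define g where "g x = F (SOME n. F n x < k) x" for x
  have g: "g x = F n x" if "F n x < k" for n x
    unfolding g_def using agree[OF that] someI[of "\<lambda>n. F n x < k", OF that] by metis
  have g_range: "g x < k" if "x \<in> topspace X" for x
    using colored[OF that] g by force
  have "openin X {x \<in> topspace X. g x = c}" if "c < k" for c
  proof -
    have "{x \<in> topspace X. g x = c} = (\<Union>n. {x \<in> topspace X. F n x = c})"
      using g colored that by fastforce
    then show ?thesis
      using fibres by (auto simp: clopen_fibres_def clopen_in_def)
  qed
  moreover have "{x \<in> topspace X. g x \<in> V} = (\<Union>c\<in>V. {x \<in> topspace X. g x = c})" for V
    by auto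
  ultimately have "continuous_map X (discrete_topology {..<k}) g"
    using g_range by (auto simp: continuous_map_def intro!: openin_Union)
  moreover have "\<not> violates g C" if C: "C \<in> \<B>" for C
  proof
    assume viol: "violates g C"
    have "\<forall>x\<in>dom_of C. \<exists>n. F n x < k"
      using colored dom_subset[OF C] by blast
    then obtain t where t: "F (t x) x < k" if "x \<in> dom_of C" for x
      by metis
    define n where "n = Max (insert 0 (t ` dom_of C))"
    have all: "F n x < k" if "x \<in> dom_of C" for x
    proof -
      have "t x \<le> n"
        using finite_dom[OF C] that by (auto simp: n_def intro!: Max_ge)
      with t[OF that] keep[OF t[OF that]] show ?thesis by metis
    qed
    then have "{y \<in> dom_of C. \<not> F n y < k} = {}" and full: "{y \<in> dom_of C. F n y < k} = dom_of C"
      by auto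
    then have "violation_prob k (F n) C = real (card (extensions k (F n) C))"
      by (simp only: violation_prob_def card.empty) simp
    then have "real (card (extensions k (F n) C)) < 1"
      using budget[OF C, of n] small[OF C] by (simp add: within_budget_def full)
    moreover have "finite (extensions k (F n) C)"
      using finite_forbidden[OF is_constraint[OF C]] by (simp add: extensions_def)
    moreover have "restrict g (dom_of C) \<in> extensions k (F n) C"
      using viol g all by (simp add: violates_def extensions_def)
    ultimately show False
      by (auto simp: card_eq_0_iff)
  qed
  ultimately show ?thesis
    using g_range by (auto simp: is_solution_def intro!: exI[of _ g])
qed

end

section \<open>The local lemma in terms of the suprema\<close>

theorem theorem1p6:
  fixes X :: "'a topology" and k :: nat and \<B> :: "'a constraint set"
  assumes "polish_topology X" and "zero_dimensional X"
    and "k \<ge> 1"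
    and "is_csp (topspace X) k \<B>" and "continuous_csp X k \<B>"
    and "csp_vdeg (topspace X) \<B> < \<infinity>" and "csp_ord \<B> < \<infinity>"
    and "csp_p k \<B> * ennreal_of_enat (csp_vdeg (topspace X) \<B>) ^ the_enat (csp_ord \<B>) < 1"
  shows "\<exists>f. continuous_map X (discrete_topology {..<k}) f \<and> is_solution (topspace X) k \<B> f"
proof -
  obtain d where d: "csp_vdeg (topspace X) \<B> = enat d"
    using assms(6) by auto
  obtain r where r: "csp_ord \<B> = enat r"
    using assms(7) by auto
  have deg: "finite {C \<in> \<B>. x \<in> dom_of C} \<and> card {C \<in> \<B>. x \<in> dom_of C} \<le> d"
    if "x \<in> topspace X" for x
  proof -
    have "ecard {C \<in> \<B>. x \<in> dom_of C} \<le> enat d"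
      unfolding d[symmetric] csp_vdeg_def by (rule SUP_upper[OF that])
    then show ?thesis by (auto simp: ecard_def split: if_splits)
  qed
  have dom: "finite (dom_of C)" "dom_of C \<subseteq> topspace X" if "C \<in> \<B>" for C
    using assms(4) that by (auto simp: is_csp_def is_constraint_def)
  have ord: "card (dom_of C) \<le> r" if "C \<in> \<B>" for C
  proof -
    have "ecard (dom_of C) \<le> enat r"
      unfolding r[symmetric] csp_ord_def by (rule SUP_upper[OF that])
    then show ?thesis using dom(1)[OF that] by (simp add: ecard_def)
  qed
  interpret bounded_continuous_csp X k \<B> d r
    by unfold_locales (use assms deg ord in auto)
  have p: "constraint_prob k C * real d ^ r < 1" if "C \<in> \<B>" for C
  proof -
    have nonneg: "0 \<le> constraint_prob k C"
      by (simp add: constraint_prob_def)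
    have "ennreal (constraint_prob k C) \<le> csp_p k \<B>"
      unfolding csp_p_def by (rule SUP_upper[OF that])
    then have "ennreal (constraint_prob k C) * of_nat d ^ r \<le> csp_p k \<B> * of_nat d ^ r"
      by (rule mult_right_mono) simp
    also have "\<dots> < 1"
      using assms(8) by (simp add: d r)
    finally have "ennreal (constraint_prob k C) * of_nat d ^ r < 1" .
    then have "ennreal (constraint_prob k C * real d ^ r) < ennreal 1"
      using nonneg by (simp add: ennreal_mult' ennreal_power ennreal_of_nat_eq_real_of_nat)
    then show ?thesis by (simp add: ennreal_less_iff nonneg)
  qed
  have "constraint_prob k C * real d ^ card (dom_of C) < 1" if C: "C \<in> \<B>" for C
  proof (cases "d = 0")
    case True
    \<comment> \<open>Then all domains are empty, so the order is 0 as well and both powers are \<open>0 ^ 0 = 1\<close>.\<close>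
    have "x \<notin> dom_of C'" if C': "C' \<in> \<B>" for C' x
    proof
      assume x: "x \<in> dom_of C'"
      then have "finite {C \<in> \<B>. x \<in> dom_of C}" "card {C \<in> \<B>. x \<in> dom_of C} = 0"
        using deg[of x] dom(2)[OF C'] True by auto
      then have "{C \<in> \<B>. x \<in> dom_of C} = {}"
        by (simp only: card_0_eq)
      with C' x show False by blast
    qed
    then have empty: "dom_of C' = {}" if "C' \<in> \<B>" for C'
      using that by blast
    have "csp_ord \<B> \<le> 0"
      unfolding csp_ord_def by (rule SUP_least) (simp add: empty ecard_def flip: zero_enat_def)
    then have "csp_ord \<B> = 0" "dom_of C = {}"
      using empty[OF C] by simp_all
    then show ?thesis
      using p[OF C] by (simp add: r zero_enat_def)
  next
    case False
    then have "constraint_prob k C * real d ^ card (dom_of C) \<le> constraint_prob k C * real d ^ r"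
      using ord[OF C] by (intro mult_left_mono power_increasing) (auto simp: constraint_prob_def)
    with p[OF C] show ?thesis by simp
  qed
  then show ?thesis
    using continuous_solution assms(1,2) by blast
qed

end
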